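(* Let $E_1,\dots,E_m$ and $F$ be Banach spaces and $T\in\mathcal{L}(E_1,\dots,E_m;F)$. Then $T\in\mathcal{L}_{DP}^{\mathrm{ev}}(E_1,\dots,E_m;F)$ if and only if, for every $(a_1,\dots,a_m)\in E_1\times\cdots\times E_m$ and all weakly null sequences $(x_j^{(i)})_{j=1}^{\infty}$ in $E_i$, $i=1,\dots,m$, we have $$\|T(x_j^{(1)}+a_1,\dots,x_j^{(m)}+a_m)-T(a_1,\dots,a_m)\|\longrightarrow0 .$$
   Context: Banach spaces are over $\mathbb{K}=\mathbb{R}$ or $\mathbb{C}$; $\overset{w}{\to}$ denotes weak convergence of sequences; $\mathcal{L}(E_1,\dots,E_m;F)$ is the space of continuous $m$-linear operators. $T\in\mathcal{L}_{DP}^{\mathrm{ev}}(E_1,\dots,E_m;F)$ (Dunford–Pettis at every point) if for all $(a_1,\dots,a_m)\in E_1\times\cdots\times E_m$ and all sequences $x_j^{(i)}\overset{w}{\to}a_i$ in $E_i$ ($i=1,\dots,m$), $T(x_j^{(1)},\dots,x_j^{(m)})\to T(a_1,\dots,a_m)$ in norm. *)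

theory Defs
  imports "HOL-Analysis.Analysis" "HOL-Algebra.Module"
begin

section \<open>Banach spaces with explicit carriers\<close>

text \<open>
  A finite family of Banach spaces with no relation to one another is a family of records whose
  carriers are subsets of one type. This costs no generality: the type can be taken to contain
  disjoint copies of the underlying sets, and each space has its own operations and its own norm.

  The scalars are a type of class \<^class>\<open>real_normed_field\<close> (commutative, with multiplicative norm).
  The instances include \<^typ>\<open>real\<close> and \<^typ>\<open>complex\<close>, and by the Gelfand--Mazur theorem these are
  the only ones up to isomorphism.
\<close>

definition scalar_ring :: "'k::real_normed_field ring" where
  "scalar_ring = \<lparr>carrier = UNIV, monoid.mult = (*), one = 1, ring.zero = 0, add = (+)\<rparr>"

text \<open>As always for modules in HOL-Algebra, the ring multiplication and unit of the record are
  not used.\<close>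

record ('k, 'a) normed_module = "('k, 'a) module" +
  vnorm :: "'a \<Rightarrow> real"

text \<open>The distance is cut off outside the carrier because \<^locale>\<open>Metric_space\<close> requires symmetry and
  nonnegativity on the whole type.\<close>

definition norm_metric :: "('k, 'a) normed_module \<Rightarrow> 'a metric" where
  "norm_metric V = metric (carrier V,
     \<lambda>u v. if u \<in> carrier V \<and> v \<in> carrier V then vnorm V (u \<ominus>\<^bsub>V\<^esub> v) else 0)"

abbreviation norm_topology :: "('k, 'a) normed_module \<Rightarrow> 'a topology" where
  "norm_topology V \<equiv> mtopology_of (norm_metric V)"

locale normed_space = module scalar_ring V
  for V :: "('k::real_normed_field, 'a) normed_module" (structure) +
  assumes vnorm_nonneg: "u \<in> carrier V \<Longrightarrow> 0 \<le> vnorm V u"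
    and vnorm_eq_0_iff: "u \<in> carrier V \<Longrightarrow> vnorm V u = 0 \<longleftrightarrow> u = \<zero>"
    and vnorm_smult: "u \<in> carrier V \<Longrightarrow> vnorm V (c \<odot> u) = norm c * vnorm V u"
    and vnorm_triangle:
      "\<lbrakk>u \<in> carrier V; v \<in> carrier V\<rbrakk> \<Longrightarrow> vnorm V (u \<oplus> v) \<le> vnorm V u + vnorm V v"

locale banach_space = normed_space +
  assumes complete: "mcomplete_of (norm_metric V)"

lemma (in normed_space) Metric_space_vnorm:
  "Metric_space (carrier V)
     (\<lambda>u v. if u \<in> carrier V \<and> v \<in> carrier V then vnorm V (u \<ominus> v) else 0)"
proof -
  have comm: "vnorm V (u \<ominus> v) = vnorm V (v \<ominus> u)" if u: "u \<in> carrier V" and v: "v \<in> carrier V" for u v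
  proof -
    have eq: "v \<ominus> u = (- 1) \<odot> (u \<ominus> v)"
    proof -
      have one: "\<one>\<^bsub>scalar_ring\<^esub> = (1::'k)" and ca: "carrier scalar_ring = (UNIV::'k set)"
        by (simp_all add: scalar_ring_def)
      have "\<ominus>\<^bsub>scalar_ring\<^esub> (1::'k) = - 1"
        by (rule R.minus_equality) (simp_all add: scalar_ring_def)
      then have "(- 1) \<odot> (u \<ominus> v) = \<ominus> (1 \<odot> (u \<ominus> v))"
        using smult_l_minus[of 1 "u \<ominus> v"] u v ca by simp
      also have "\<dots> = \<ominus> (u \<ominus> v)"
        using smult_one[of "u \<ominus> v"] u v one by simp
      also have "\<dots> = v \<ominus> u"
        using u v by (simp add: a_minus_def minus_add a_comm)
      finally show ?thesis by simp
    qed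
    show ?thesis
      unfolding eq using u v by (simp add: vnorm_smult)
  qed
  show ?thesis
  proof
    fix u v
    show "0 \<le> (if u \<in> carrier V \<and> v \<in> carrier V then vnorm V (u \<ominus> v) else 0)"
      by (simp add: vnorm_nonneg)
    show "(if u \<in> carrier V \<and> v \<in> carrier V then vnorm V (u \<ominus> v) else 0)
        = (if v \<in> carrier V \<and> u \<in> carrier V then vnorm V (v \<ominus> u) else 0)"
      by (auto simp: comm)
  next
    fix u v assume u: "u \<in> carrier V" and v: "v \<in> carrier V"
    have "u \<ominus> v = \<zero> \<longleftrightarrow> u = v"
      using u v by (metis M.add.inv_closed M.minus_equality M.r_neg M.minus_minus a_minus_def)
    then show "((if u \<in> carrier V \<and> v \<in> carrier V then vnorm V (u \<ominus> v) else 0) = 0) = (u = v)"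
      using u v by (simp add: vnorm_eq_0_iff)
  next
    fix u v w assume u: "u \<in> carrier V" and v: "v \<in> carrier V" and w: "w \<in> carrier V"
    have "u \<ominus> w = (u \<ominus> v) \<oplus> (v \<ominus> w)"
      using u v w by (simp add: a_minus_def a_assoc r_neg2 l_neg r_neg1 )
    then have "vnorm V (u \<ominus> w) \<le> vnorm V (u \<ominus> v) + vnorm V (v \<ominus> w)"
      using u v w by (simp add: vnorm_triangle)
    then show "(if u \<in> carrier V \<and> w \<in> carrier V then vnorm V (u \<ominus> w) else 0)
        \<le> (if u \<in> carrier V \<and> v \<in> carrier V then vnorm V (u \<ominus> v) else 0)
          + (if v \<in> carrier V \<and> w \<in> carrier V then vnorm V (v \<ominus> w) else 0)"
      using u v w by simp
  qed
qed


section \<open>Weak convergence\<close>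

text \<open>The topological dual. Only the values of a functional on the carrier matter.\<close>

definition dual :: "('k::real_normed_field, 'a) normed_module \<Rightarrow> ('a \<Rightarrow> 'k) set" where
  "dual V = {\<phi>.
     (\<forall>u\<in>carrier V. \<forall>v\<in>carrier V. \<phi> (u \<oplus>\<^bsub>V\<^esub> v) = \<phi> u + \<phi> v) \<and>
     (\<forall>c. \<forall>u\<in>carrier V. \<phi> (c \<odot>\<^bsub>V\<^esub> u) = c * \<phi> u) \<and>
     continuous_map (norm_topology V) euclidean \<phi>}"

definition weakly_converges ::
    "('k::real_normed_field, 'a) normed_module \<Rightarrow> (nat \<Rightarrow> 'a) \<Rightarrow> 'a \<Rightarrow> bool" where
  "weakly_converges V x a \<longleftrightarrow>
     range x \<subseteq> carrier V \<and> a \<in> carrier V \<and>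
     (\<forall>\<phi>\<in>dual V. (\<lambda>j. \<phi> (x j)) \<longlonglongrightarrow> \<phi> a)"


section \<open>Multilinear operators\<close>

text \<open>Elements of \<open>E\<^sub>1 \<times> \<dots> \<times> E\<^sub>m\<close> are extensional functions on \<open>{1..m}\<close>, and \<open>T\<close> is
  relevant only there.\<close>

abbreviation space_product :: "nat \<Rightarrow> (nat \<Rightarrow> ('k, 'a) normed_module) \<Rightarrow> (nat \<Rightarrow> 'a) set" where
  "space_product m E \<equiv> \<Pi>\<^sub>E i\<in>{1..m}. carrier (E i)"

definition multilinear_ops ::
    "nat \<Rightarrow> (nat \<Rightarrow> ('k::real_normed_field, 'a) normed_module) \<Rightarrow> ('k, 'b) normed_module \<Rightarrow>
     ((nat \<Rightarrow> 'a) \<Rightarrow> 'b) set" where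
  "multilinear_ops m E F = {T.
     T \<in> space_product m E \<rightarrow> carrier F \<and>
     (\<forall>x\<in>space_product m E. \<forall>i\<in>{1..m}.
        (\<forall>u\<in>carrier (E i). \<forall>v\<in>carrier (E i).
           T (x(i := u \<oplus>\<^bsub>E i\<^esub> v)) = T (x(i := u)) \<oplus>\<^bsub>F\<^esub> T (x(i := v))) \<and>
        (\<forall>c. \<forall>u\<in>carrier (E i). T (x(i := c \<odot>\<^bsub>E i\<^esub> u)) = c \<odot>\<^bsub>F\<^esub> T (x(i := u)))) \<and>
     continuous_map (product_topology (\<lambda>i. norm_topology (E i)) {1..m}) (norm_topology F) T}"

definition DP_everywhere ::
    "nat \<Rightarrow> (nat \<Rightarrow> ('k::real_normed_field, 'a) normed_module) \<Rightarrow> ('k, 'b) normed_module \<Rightarrow>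
     ((nat \<Rightarrow> 'a) \<Rightarrow> 'b) set" where
  "DP_everywhere m E F = {T \<in> multilinear_ops m E F.
     \<forall>a\<in>space_product m E. \<forall>x :: nat \<Rightarrow> nat \<Rightarrow> 'a.
       (\<forall>i\<in>{1..m}. weakly_converges (E i) (x i) (a i)) \<longrightarrow>
       limitin (norm_topology F) (\<lambda>j. T (\<lambda>i\<in>{1..m}. x i j)) (T a) sequentially}"

end

theory Submission
  imports Defs
begin

text \<open>Weak convergence is invariant under translation: a continuous functional is additive, so
  adding a fixed vector to a sequence only adds a constant to its scalar images
  (\<open>weakly_converges_add_const\<close>). Hence the substitution x = y + a, with inverse y = x
  - a, matches the sequences converging weakly to the coordinates of a with the weakly null ones,
  and it does so in every coordinate at once. Under it the two conditions concern the same values of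
  \<open>T\<close>. The topological limit in \<open>DP_everywhere\<close> is first turned into
  convergence of norms by \<open>limitin_norm_topology\<close>.\<close>

text \<open>All points involved lie in the carrier, so the cut-off in the distance never takes
  effect and the usual metric criterion for limits applies.\<close>

lemma (in normed_space) limitin_norm_topology:
  assumes "range f \<subseteq> carrier V" "l \<in> carrier V"
  shows "limitin (norm_topology V) f l sequentially \<longleftrightarrow> (\<lambda>j. vnorm V (f j \<ominus> l)) \<longlonglongrightarrow> 0"
proof -
  let ?d = "\<lambda>u v. if u \<in> carrier V \<and> v \<in> carrier V then vnorm V (u \<ominus> v) else 0"
  interpret Metric_space "carrier V" ?d
    by (rule Metric_space_vnorm)
  have "norm_topology V = mtopology"
    by (simp add: norm_metric_def mtopology_of)
  moreover have "?d (f j) l = vnorm V (f j \<ominus> l)" for j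
    using assms by auto
  ultimately show ?thesis
    using assms by (simp add: limitin_metric_dist_null image_subset_iff)
qed

text \<open>Additivity of a functional splits off the constant \<phi> b. Since additivity is only
  known on the carrier, the range of the sequence has to be kept inside it.\<close>

lemma (in normed_space) weakly_converges_add_const:
  assumes "weakly_converges V x a" "b \<in> carrier V"
  shows "weakly_converges V (\<lambda>j. x j \<oplus> b) (a \<oplus> b)"
proof -
  have x: "range x \<subseteq> carrier V" and a: "a \<in> carrier V"
    using assms(1) by (auto simp: weakly_converges_def)
  have "(\<lambda>j. \<phi> (x j \<oplus> b)) \<longlonglongrightarrow> \<phi> (a \<oplus> b)" if \<phi>: "\<phi> \<in> dual V" for \<phi>
  proof -
    have "\<phi> (u \<oplus> b) = \<phi> u + \<phi> b" if "u \<in> carrier V" for u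
      using \<phi> that assms(2) by (auto simp: dual_def)
    moreover have "(\<lambda>j. \<phi> (x j)) \<longlonglongrightarrow> \<phi> a"
      using assms(1) \<phi> by (auto simp: weakly_converges_def)
    ultimately show ?thesis
      using x a by (simp add: image_subset_iff tendsto_add)
  qed
  with x a assms(2) show ?thesis
    by (auto simp: weakly_converges_def)
qed

theorem proposition2p3:
  fixes m :: nat
    and E :: "nat \<Rightarrow> ('k::real_normed_field, 'a) normed_module"
    and F :: "('k, 'b) normed_module"
    and T :: "(nat \<Rightarrow> 'a) \<Rightarrow> 'b"
  assumes "1 \<le> m"
    and "\<And>i. i \<in> {1..m} \<Longrightarrow> banach_space (E i)"
    and "banach_space F"
    and "T \<in> multilinear_ops m E F"
  shows "T \<in> DP_everywhere m E F \<longleftrightarrow>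
    (\<forall>a\<in>space_product m E. \<forall>x :: nat \<Rightarrow> nat \<Rightarrow> 'a.
       (\<forall>i\<in>{1..m}. weakly_converges (E i) (x i) \<zero>\<^bsub>E i\<^esub>) \<longrightarrow>
       (\<lambda>j. vnorm F (T (\<lambda>i\<in>{1..m}. x i j \<oplus>\<^bsub>E i\<^esub> a i) \<ominus>\<^bsub>F\<^esub> T a)) \<longlonglongrightarrow> 0)"
proof -
  interpret F: banach_space F by fact
  have E: "normed_space (E i)" if "i \<in> {1..m}" for i
    using assms(2)[OF that] by (simp add: banach_space_def)
  have grp: "abelian_group (E i)" if "i \<in> {1..m}" for i
    using E[OF that] by (simp add: normed_space_def module_def)
  have T: "T y \<in> carrier F" if "y \<in> space_product m E" for y
    using assms(4) that by (auto simp: multilinear_ops_def)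
  \<comment> \<open>With both conditions stated through \<open>vnorm\<close>, they differ only by a
    translation of the sequences. Weak convergence puts the arguments of \<open>T\<close> in the
    product, as \<open>limitin_norm_topology\<close> requires.\<close>
  have DP_iff: "T \<in> DP_everywhere m E F \<longleftrightarrow>
    (\<forall>a\<in>space_product m E. \<forall>x :: nat \<Rightarrow> nat \<Rightarrow> 'a.
       (\<forall>i\<in>{1..m}. weakly_converges (E i) (x i) (a i)) \<longrightarrow>
       (\<lambda>j. vnorm F (T (\<lambda>i\<in>{1..m}. x i j) \<ominus>\<^bsub>F\<^esub> T a)) \<longlonglongrightarrow> 0)"
  proof -
    have "limitin (norm_topology F) (\<lambda>j. T (\<lambda>i\<in>{1..m}. x i j)) (T a) sequentially \<longleftrightarrow>
        (\<lambda>j. vnorm F (T (\<lambda>i\<in>{1..m}. x i j) \<ominus>\<^bsub>F\<^esub> T a)) \<longlonglongrightarrow> 0"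
      if "a \<in> space_product m E" "\<forall>i\<in>{1..m}. weakly_converges (E i) (x i) (a i)"
      for a and x :: "nat \<Rightarrow> nat \<Rightarrow> 'a"
    proof -
      have "(\<lambda>i\<in>{1..m}. x i j) \<in> space_product m E" for j
        using that(2) by (simp add: weakly_converges_def image_subset_iff)
      then show ?thesis
        using that(1) by (intro F.limitin_norm_topology image_subsetI T)
    qed
    then show ?thesis
      unfolding DP_everywhere_def mem_Collect_eq using assms(4) by meson
  qed
  show ?thesis
    unfolding DP_iff
  proof (intro iffI ballI allI impI)
    fix a and x :: "nat \<Rightarrow> nat \<Rightarrow> 'a"
    assume DP: "\<forall>a\<in>space_product m E. \<forall>x :: nat \<Rightarrow> nat \<Rightarrow> 'a.
        (\<forall>i\<in>{1..m}. weakly_converges (E i) (x i) (a i)) \<longrightarrow>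
        (\<lambda>j. vnorm F (T (\<lambda>i\<in>{1..m}. x i j) \<ominus>\<^bsub>F\<^esub> T a)) \<longlonglongrightarrow> 0"
      and a: "a \<in> space_product m E"
      and x: "\<forall>i\<in>{1..m}. weakly_converges (E i) (x i) \<zero>\<^bsub>E i\<^esub>"
    have "weakly_converges (E i) (\<lambda>j. x i j \<oplus>\<^bsub>E i\<^esub> a i) (a i)" if i: "i \<in> {1..m}" for i
    proof -
      interpret abelian_group "E i" using grp[OF i] .
      have "a i \<in> carrier (E i)"
        using a i by blast
      \<comment> \<open>Translating a weakly null sequence by \<open>a i\<close> gives the weak
        limit 0 + \<open>a i\<close>, which the group laws reduce to \<open>a i\<close>.\<close>
      then show ?thesis
        using normed_space.weakly_converges_add_const[OF E[OF i] bspec[OF x i]] by force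
    qed
    then show "(\<lambda>j. vnorm F (T (\<lambda>i\<in>{1..m}. x i j \<oplus>\<^bsub>E i\<^esub> a i) \<ominus>\<^bsub>F\<^esub> T a)) \<longlonglongrightarrow> 0"
      by (intro DP[rule_format, OF a]) blast
  next
    fix a and x :: "nat \<Rightarrow> nat \<Rightarrow> 'a"
    assume null: "\<forall>a\<in>space_product m E. \<forall>x :: nat \<Rightarrow> nat \<Rightarrow> 'a.
        (\<forall>i\<in>{1..m}. weakly_converges (E i) (x i) \<zero>\<^bsub>E i\<^esub>) \<longrightarrow>
        (\<lambda>j. vnorm F (T (\<lambda>i\<in>{1..m}. x i j \<oplus>\<^bsub>E i\<^esub> a i) \<ominus>\<^bsub>F\<^esub> T a)) \<longlonglongrightarrow> 0"
      and a: "a \<in> space_product m E"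
      and x: "\<forall>i\<in>{1..m}. weakly_converges (E i) (x i) (a i)"
    \<comment> \<open>The inverse substitution: translation by the negative of \<open>a i\<close>
      moves the weak limit to zero, and adding \<open>a i\<close> back recovers
      \<open>x\<close>.\<close>
    define y where "y = (\<lambda>i j. x i j \<ominus>\<^bsub>E i\<^esub> a i)"
    have y: "weakly_converges (E i) (y i) \<zero>\<^bsub>E i\<^esub> \<and> (\<forall>j. y i j \<oplus>\<^bsub>E i\<^esub> a i = x i j)"
      if i: "i \<in> {1..m}" for i
    proof -
      interpret abelian_group "E i" using grp[OF i] .
      have ai: "a i \<in> carrier (E i)"
        using a i by blast
      moreover have "x i j \<in> carrier (E i)" for j
        using bspec[OF x i] by (simp add: weakly_converges_def image_subset_iff)
      moreover have "weakly_converges (E i) (y i) \<zero>\<^bsub>E i\<^esub>"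
        using normed_space.weakly_converges_add_const
            [OF E[OF i] bspec[OF x i], of "\<ominus>\<^bsub>E i\<^esub> a i"] ai
        by (simp add: y_def a_minus_def r_neg)
      ultimately show ?thesis
        by (simp add: y_def a_minus_def a_assoc l_neg)
    qed
    \<comment> \<open>The recovery of \<open>x\<close> is known only for indices in
      \<open>{1..m}\<close>; restriction makes this enough for equality of the two tuples.\<close>
    have "(\<lambda>i\<in>{1..m}. y i j \<oplus>\<^bsub>E i\<^esub> a i) = (\<lambda>i\<in>{1..m}. x i j)" for j
      using y by (intro restrict_ext) blast
    moreover have "(\<lambda>j. vnorm F (T (\<lambda>i\<in>{1..m}. y i j \<oplus>\<^bsub>E i\<^esub> a i) \<ominus>\<^bsub>F\<^esub> T a)) \<longlonglongrightarrow> 0"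
      using y by (intro null[rule_format, OF a]) blast
    ultimately show "(\<lambda>j. vnorm F (T (\<lambda>i\<in>{1..m}. x i j) \<ominus>\<^bsub>F\<^esub> T a)) \<longlonglongrightarrow> 0"
      by simp
  qed
qed

end
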